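(* Let $s>0$ and $t>0$, let $d_t$ be the fractional dyadic diffusion metric of order $s$ at time $t$ on $\mathbb{R}^+=\{x\ge 0\}$, let $\delta$ be the dyadic distance, and let $\psi_t$ be the function defined in the context, with $\psi_t(0):=0$. Then: (1) $d_t(x,y)=\psi_t(\delta(x,y))$ for $x,y\in\mathbb{R}^+$; (2) the family of $d_t$-balls, given as usual by $B_t(x,r)=\{y\in\mathbb{R}^+\colon d_t(x,y)<r\}$ for $x\in\mathbb{R}^+$ and $r>0$, coincides with $\mathscr{D}$, the family of all dyadic intervals.
   Context: $\mathbb{R}^+=\{x\in\mathbb{R}\colon x\ge 0\}$ and $\mathbb{N}_0=\{0,1,2,\dots\}$. The family of dyadic intervals is $\mathscr{D}=\{I^j_k=[k2^{-j},(k+1)2^{-j})\colon j\in\mathbb{Z},\,k\in\mathbb{N}_0\}$; $|I|$ denotes the length of $I$. Dyadic distance: $\delta(x,y)=\inf\{|I|\colon I\in\mathscr{D},\ x,y\in I\}$ for $x,y\in\mathbb{R}^+$. For $x\ne y$ this is the length of the smallest dyadic interval containing both points, and $\delta(x,x)=0$. Haar system: $\mathscr{H}=\{h^j_k(x)=2^{j/2}h^0_0(2^jx-k)\colon j\in\mathbb{Z},\,k\in\mathbb{N}_0\}$, where $h^0_0=\chi_{[0,1/2)}-\chi_{[1/2,1)}$ and $\chi_E$ is the indicator function of $E$. It is an orthonormal basis of $L^2(\mathbb{R}^+)$. For $h=h^j_k$, $I(h)=I^j_k$ is the dyadic interval supporting $h$. Diffusion kernel: for $s,t>0$ and $x,y\in\mathbb{R}^+$,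 $K_s(x,y;t)=\sum_{h\in\mathscr{H}}e^{-t|I(h)|^{-s}}h(x)h(y)$. Fractional dyadic diffusion distance of order $s$ at time $t$: $d_t(x,y)=\left(\int_{\mathbb{R}^+}|K_s(x,z;t)-K_s(y,z;t)|^2\,dz\right)^{1/2}$. Function $\psi_t$ (depending also on $s$): for $\lambda>0$, $\psi_t(\lambda)=\sqrt{\frac{2}{\lambda}\,\eta_t(\lambda^{-s})}$, where $\eta_t(\sigma)=2e^{-2t\sigma}+\sum_{\ell\ge 1}2^\ell e^{-2t2^{s\ell}\sigma}$ for $\sigma>0$; and $\psi_t(0):=0$.
   Formalization: Part (2) is false as stated: d_t is bounded, so balls of large radius equal all of ℝ⁺, which is not a dyadic interval. The formal version states that the family of d_t-balls is exactly 𝒟 together with ℝ⁺. *)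

theory Defs
  imports "HOL-Analysis.Analysis"
begin

definition dyadic_interval :: "int \<Rightarrow> nat \<Rightarrow> real set" where
  "dyadic_interval j k = {real k * 2 powi (- j) ..< (real k + 1) * 2 powi (- j)}"

definition dyadic_intervals :: "real set set" where
  "dyadic_intervals = {dyadic_interval j k | j k. True}"

definition dyadic_dist :: "real \<Rightarrow> real \<Rightarrow> real" where
  "dyadic_dist x y = Inf {measure lborel I | I. I \<in> dyadic_intervals \<and> x \<in> I \<and> y \<in> I}"

definition haar_mother :: "real \<Rightarrow> real" where
  "haar_mother x = indicator {0..<1/2} x - indicator {1/2..<1} x"

definition haar :: "int \<Rightarrow> nat \<Rightarrow> real \<Rightarrow> real" where
  "haar j k x = 2 powr (real_of_int j / 2) * haar_mother (2 powi j * x - real k)"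

text \<open>The Haar system is summed over its indices; \<open>(j, k) \<mapsto> haar j k\<close> is injective, and
  \<open>dyadic_interval j k\<close> is the interval \<open>I(h)\<close> supporting \<open>h = haar j k\<close>.\<close>

definition diffusion_kernel :: "real \<Rightarrow> real \<Rightarrow> real \<Rightarrow> real \<Rightarrow> real" where
  "diffusion_kernel s t x y =
     (\<Sum>\<^sub>\<infinity>(j, k)\<in>(UNIV :: (int \<times> nat) set).
        exp (- t * measure lborel (dyadic_interval j k) powr (- s)) * haar j k x * haar j k y)"

definition diffusion_dist :: "real \<Rightarrow> real \<Rightarrow> real \<Rightarrow> real \<Rightarrow> real" where
  "diffusion_dist s t x y =
     sqrt (LINT z:{0..}|lborel. \<bar>diffusion_kernel s t x z - diffusion_kernel s t y z\<bar>\<^sup>2)"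

definition diffusion_eta :: "real \<Rightarrow> real \<Rightarrow> real \<Rightarrow> real" where
  "diffusion_eta s t \<sigma> =
     2 * exp (- 2 * t * \<sigma>)
       + (\<Sum>\<^sub>\<infinity>l\<in>{1::nat..}. 2 ^ l * exp (- 2 * t * 2 powr (s * real l) * \<sigma>))"

definition diffusion_psi :: "real \<Rightarrow> real \<Rightarrow> real \<Rightarrow> real" where
  "diffusion_psi s t u =
     (if u = 0 then 0 else sqrt (2 / u * diffusion_eta s t (u powr (- s))))"

text \<open>The distance is bounded: \<open>(diffusion_dist s t x y)\<^sup>2\<close> is less than twice the sum of
  \<open>2 powi j * exp (- 2 * t * 2 powr (s * j))\<close> over all integers \<open>j\<close>. Hence every ball of
  sufficiently large radius is the whole half-line \<open>{0..}\<close>, which is not a dyadic interval.\<close>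

definition diffusion_ball :: "real \<Rightarrow> real \<Rightarrow> real \<Rightarrow> real \<Rightarrow> real set" where
  "diffusion_ball s t x r = {y. y \<ge> 0 \<and> diffusion_dist s t x y < r}"

end

theory Submission
  imports Defs
begin

text \<open>
  Two distinct points \<open>x\<close>, \<open>y\<close> of the half-line have a splitting level \<open>J\<close>: they share a dyadic interval
  of level \<open>j\<close> exactly for \<open>j \<le> J\<close>, so \<open>dyadic_dist x y = 2 powi (- J)\<close>. The function
  \<open>K(x, \<cdot>) - K(y, \<cdot>)\<close> has the Haar coefficients \<open>exp (- t * |I(h)| powr (- s)) * (h x - h y)\<close>, and Parseval's
  identity expresses the squared diffusion distance as the sum of their squares. Levels coarser than \<open>J\<close>
  contribute nothing, since \<open>h\<close> does not separate the points. At level \<open>J\<close> the single Haar function whose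
  halves separate them contributes 4 units, and at each finer level the two functions seeing one point each
  contribute 2 units, a unit at level \<open>j\<close> being the weight \<open>w j = 2 powi j * exp (- 2 * t * 2 powr (s * j))\<close>
  (\<open>integral_level_kernel_difference\<close>). The result is
  \<open>4 * w J + 2 * (w (J + 1) + w (J + 2) + \<dots>)\<close>, which is the square of \<open>diffusion_psi\<close> at \<open>2 powi (- J)\<close>.

  Parseval's identity rests on the orthonormality of the Haar system (\<open>haar_orthonormal\<close>): the difference
  of the kernels is given as a Haar series, it is supported in the common interval of level \<open>J\<close>, and its
  levels have summable sup-norms, so the integral of the square is the limit of the integrals of the squared
  partial sums (\<open>sums_integral_square\<close>).

  For the balls, the value of the distance decreases strictly in \<open>J\<close>
  (\<open>gap_energy_strict_mono\<close>) and tends to 0. Hence the diffusion distance orders points as the dyadic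
  distance does, and a ball of radius at most some value of the distance is the set of points that
  share with the centre a dyadic interval of a fixed level. As \<open>J\<close> tends to \<open>- \<infinity>\<close>
  the values stay bounded, because the weights are summable over all levels; larger balls are the whole
  half-line.
\<close>

section \<open>Dyadic cells and the dyadic distance\<close>

text \<open>The index of the level-\<open>j\<close> dyadic interval containing \<open>x\<close>. Working with floors turns the nesting of
  dyadic intervals into integer division.\<close>
definition cell :: "int \<Rightarrow> real \<Rightarrow> int" where
  "cell j x = \<lfloor>2 powi j * x\<rfloor>"

lemma mem_dyadic_interval_iff: "x \<in> dyadic_interval j k \<longleftrightarrow> cell j x = int k"
proof -
  have "(2::real) powi j > 0" by simp
  then show ?thesis
    unfolding dyadic_interval_def cell_def floor_eq_iff
    by (auto simp: power_int_minus field_simps)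
qed

lemma cell_nonneg_iff: "cell j x \<ge> 0 \<longleftrightarrow> x \<ge> 0"
proof -
  have "(2::real) powi j > 0" by simp
  then have "0 \<le> 2 powi j * x \<longleftrightarrow> x \<ge> 0"
    using mult_less_cancel_left_pos[of "2 powi j" x 0] by (metis linorder_not_less mult_zero_right)
  then show ?thesis by (simp add: cell_def)
qed

lemma cell_nonneg: "x \<ge> 0 \<Longrightarrow> cell j x \<ge> 0"
  by (simp add: cell_nonneg_iff)

text \<open>An interval of level \<open>i\<close> is a union of \<open>2 ^ (j - i)\<close> consecutive intervals of the finer level \<open>j\<close>.\<close>
lemma cell_div:
  assumes "i \<le> j"
  shows "cell i x = cell j x div 2 ^ nat (j - i)"
proof -
  have "(2::real) powi j = 2 powi i * 2 ^ nat (j - i)"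
    using assms by (simp flip: power_int_of_nat power_int_add)
  then have "2 powi i * x = 2 powi j * x / real_of_int (2 ^ nat (j - i))"
    by simp
  then show ?thesis
    unfolding cell_def by (simp only: floor_divide_real_eq_div zero_le_power zero_le_numeral)
qed

lemma cell_coarsen: "i \<le> j \<Longrightarrow> cell j x = cell j y \<Longrightarrow> cell i x = cell i y"
  by (simp add: cell_div)

lemma cell_child: "cell (j + 1) x = 2 * cell j x \<or> cell (j + 1) x = 2 * cell j x + 1"
  using cell_div[of j "j + 1" x] by simp presburger

text \<open>A dyadic interval \<open>{0..<2 ^ n}\<close> with \<open>n\<close> large contains both points. This fails for points on different
  sides of 0, which is why the theory lives on the half-line.\<close>
lemma cell_eq_coarse:
  assumes "x \<ge> 0" "y \<ge> 0"
  shows "\<exists>j. cell j x = cell j y"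
proof -
  obtain n where n: "max x y < 2 ^ n"
    using real_arch_pow[of 2 "max x y"] by auto
  have "cell (- int n) u = 0" if "0 \<le> u" "u \<le> max x y" for u
    using n that by (auto simp: cell_def floor_eq_iff power_int_minus field_simps)
  then show ?thesis using assms by (metis max.cobounded1 max.cobounded2)
qed

text \<open>Two points of one interval are at most its length apart.\<close>
lemma cell_neq_fine:
  assumes "x \<noteq> y"
  shows "\<exists>j. cell j x \<noteq> cell j y"
proof -
  obtain n where n: "1 / \<bar>x - y\<bar> < 2 ^ n"
    using real_arch_pow[of 2] by auto
  then have "1 < \<bar>2 ^ n * x - 2 ^ n * y\<bar>"
    using assms
    by (simp only: right_diff_distrib[symmetric] abs_mult) (simp add: divide_less_eq mult.commute)
  then have "cell (int n) x \<noteq> cell (int n) y"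
    unfolding cell_def by (simp, linarith)
  then show ?thesis ..
qed

lemma int_last_before_change:
  fixes P :: "int \<Rightarrow> bool"
  assumes "P i" "\<not> P n" "i \<le> n"
  obtains m where "P m" "\<not> P (m + 1)"
proof -
  have "\<exists>m. P m \<and> \<not> P (m + 1)"
  proof (rule ccontr)
    assume "\<nexists>m. P m \<and> \<not> P (m + 1)"
    then have step: "P m \<Longrightarrow> P (m + 1)" for m by blast
    from assms(3) have "P n"
      by (induction n rule: int_ge_induct) (use assms(1) step in auto)
    with assms(2) show False ..
  qed
  then show thesis using that by blast
qed

text \<open>The level \<open>J\<close> of the smallest dyadic interval containing two distinct points. Both
  distances depend on the pair only through this number.\<close>
lemma splitting_level:
  assumes "x \<ge> 0" "y \<ge> 0" "x \<noteq> y"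
  obtains J where "\<And>j. cell j x = cell j y \<longleftrightarrow> j \<le> J"
proof -
  obtain i where i: "cell i x = cell i y" using cell_eq_coarse assms by blast
  obtain n where n: "cell n x \<noteq> cell n y" using cell_neq_fine assms by blast
  have "i \<le> n" using i n cell_coarsen[of n i] by force
  then obtain J where J: "cell J x = cell J y" "cell (J + 1) x \<noteq> cell (J + 1) y"
    using int_last_before_change[of "\<lambda>j. cell j x = cell j y"] i n by blast
  have "cell j x = cell j y \<longleftrightarrow> j \<le> J" for j
    using J cell_coarsen[of j J x y] cell_coarsen[of "J + 1" j x y] by linarith
  then show thesis by (rule that)
qed

lemma measure_dyadic_interval [simp]: "measure lborel (dyadic_interval j k) = 2 powi (- j)"
  by (simp add: dyadic_interval_def algebra_simps)

lemma emeasure_dyadic_interval [simp]: 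
  "emeasure lborel (dyadic_interval j k) = ennreal (2 powi (- j))"
  by (simp add: dyadic_interval_def algebra_simps)

lemma dyadic_interval_borel [measurable]: "dyadic_interval j k \<in> sets borel"
  by (simp add: dyadic_interval_def)

lemma dyadic_dist_eq_Inf:
  assumes "x \<ge> 0" "y \<ge> 0"
  shows "dyadic_dist x y = Inf {2 powi (- j) | j. cell j x = cell j y}"
proof -
  have "{measure lborel I | I. I \<in> dyadic_intervals \<and> x \<in> I \<and> y \<in> I}
      = {2 powi (- j) | j. cell j x = cell j y}" (is "?L = ?R")
  proof
    show "?L \<subseteq> ?R" by (force simp: dyadic_intervals_def mem_dyadic_interval_iff)
    show "?R \<subseteq> ?L"
    proof
      fix u assume "u \<in> ?R"
      then obtain j where j: "u = 2 powi (- j)" "cell j x = cell j y" by blast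
      let ?I = "dyadic_interval j (nat (cell j x))"
      have "x \<in> ?I" "y \<in> ?I" using j cell_nonneg[OF assms(1)] cell_nonneg[OF assms(2)] by (auto simp: mem_dyadic_interval_iff)
      then show "u \<in> ?L" using j(1) by (force simp: dyadic_intervals_def)
    qed
  qed
  then show ?thesis by (simp add: dyadic_dist_def)
qed

lemma dyadic_dist_splitting_level:
  assumes "x \<ge> 0" "y \<ge> 0" and J: "\<And>j. cell j x = cell j y \<longleftrightarrow> j \<le> J"
  shows "dyadic_dist x y = 2 powi (- J)"
  unfolding dyadic_dist_eq_Inf[OF assms(1,2)] J
  by (rule cInf_eq_minimum) (auto intro: power_int_increasing)

text \<open>The lengths of the intervals containing \<open>x\<close> tend to 0; the infimum is not attained.\<close>
lemma dyadic_dist_self: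
  assumes "x \<ge> 0"
  shows "dyadic_dist x x = 0"
  unfolding dyadic_dist_eq_Inf[OF assms assms]
proof (rule cInf_eq_non_empty)
  fix u :: real assume *: "\<And>v. v \<in> {2 powi (- j) | j. cell j x = cell j x} \<Longrightarrow> u \<le> v"
  have "u \<le> (1/2) ^ n" for n
    by (rule *) (force simp: power_int_minus field_simps intro: exI[of _ "int n"])
  moreover have "(\<lambda>n. (1/2::real) ^ n) \<longlonglongrightarrow> 0" by (rule LIMSEQ_power_zero) simp
  ultimately show "u \<le> 0" by (intro LIMSEQ_le_const) auto
qed auto

section \<open>Orthonormality of the Haar system\<close>

text \<open>On its support, a Haar function is determined by the half of the support that contains the point, that is,
  by the cell of the next finer level.\<close>
lemma haar_eq_cell:
  "haar j k x = 2 powr (real_of_int j / 2) *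
     (if cell (j + 1) x = 2 * int k then 1 else if cell (j + 1) x = 2 * int k + 1 then - 1 else 0)"
proof -
  have "cell (j + 1) x = n \<longleftrightarrow> real_of_int n \<le> 2 * (2 powi j * x) \<and> 2 * (2 powi j * x) < real_of_int n + 1" for n
    by (simp add: cell_def floor_eq_iff power_int_add mult_ac)
  then show ?thesis
    by (auto simp: haar_def haar_mother_def indicator_def)
qed

lemma haar_eq_indicator:
  "haar j k x = 2 powr (real_of_int j / 2) *
     (indicator (dyadic_interval (j + 1) (2 * k)) x - indicator (dyadic_interval (j + 1) (2 * k + 1)) x)"
  by (auto simp: haar_eq_cell indicator_def mem_dyadic_interval_iff)

lemma haar_eq_0: "cell j x \<noteq> int k \<Longrightarrow> haar j k x = 0"
  using cell_child[of j x] by (auto simp: haar_eq_cell)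

lemma haar_square: "haar j k x * haar j k x = 2 powi j * indicator (dyadic_interval j k) x"
proof -
  have "(2::real) powr (real_of_int j / 2) * 2 powr (real_of_int j / 2) = 2 powi j"
    by (simp flip: powr_add powr_real_of_int')
  then show ?thesis
    using cell_child[of j x]
    by (auto simp: haar_eq_cell indicator_def mem_dyadic_interval_iff)
qed

lemma abs_haar_le: "\<bar>haar j k x\<bar> \<le> 2 powr (real_of_int j / 2)"
  by (simp add: haar_eq_cell)

lemma haar_borel [measurable]: "haar j k \<in> borel_measurable borel"
  unfolding haar_eq_indicator[abs_def] by measurable

lemma integrable_haar: "integrable lborel (haar j k)"
  unfolding haar_eq_indicator[abs_def]
  by (intro integrable_mult_right Bochner_Integration.integrable_diff integrable_real_indicator)
     (auto)

lemma integral_haar: "integral\<^sup>L lborel (haar j k) = 0"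
  unfolding haar_eq_indicator[abs_def]
  by (subst integral_mult_right_zero, subst Bochner_Integration.integral_diff)
     (auto intro!: integrable_real_indicator)

text \<open>A Haar function is constant on each half of its support, hence on every cell of a finer level.\<close>
lemma haar_coarse_const:
  assumes "i < j" "cell j x = cell j y"
  shows "haar i l x = haar i l y"
  using cell_coarsen[of "i + 1" j x y] assms by (simp add: haar_eq_cell)

text \<open>A coarser Haar function can be frozen at the left endpoint of the support of the finer one. This reduces
  orthogonality across levels to the vanishing mean of the finer factor.\<close>
lemma haar_mult_coarse:
  assumes "i < j"
  shows "haar i l z * haar j k z = haar i l (real k * 2 powi (- j)) * haar j k z"
proof (cases "cell j z = int k")
  case True
  have "cell j (real k * 2 powi (- j)) = int k"
    by (simp add: cell_def power_int_minus mult.left_commute[of "2 powi j"])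
  then show ?thesis using haar_coarse_const[OF assms] True by metis
qed (simp add: haar_eq_0)

lemma haar_same_level: "k \<noteq> l \<Longrightarrow> haar j l z * haar j k z = 0"
  by (metis haar_eq_0 mult_eq_0_iff of_nat_eq_iff)

lemma haar_orthonormal:
  shows "integrable lborel (\<lambda>z. haar i l z * haar j k z)" (is ?A)
    and "(\<integral>z. haar i l z * haar j k z \<partial>lborel) = (if i = j \<and> l = k then 1 else 0)" (is ?B)
proof -
  consider "i < j" | "j < i" | "i = j" "l \<noteq> k" | "i = j" "l = k" by linarith
  then have "?A \<and> ?B"
  proof cases
    case 1 then show ?thesis by (simp add: haar_mult_coarse integrable_haar integral_haar)
  next
    case 2 then show ?thesis
      by (simp add: haar_mult_coarse integrable_haar integral_haar mult.commute[of "haar i l _"])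
  next
    case 3 then show ?thesis by (simp add: haar_same_level)
  next
    case 4
    then show ?thesis
      by (auto simp: haar_square power_int_minus intro!: integrable_mult_right integrable_real_indicator)
  qed
  then show ?A ?B by auto
qed

section \<open>Summation tools\<close>

text \<open>Parseval's identity for a series of orthogonal functions with a common support of finite measure and
  summable sup-norms. For finite sums it is the Pythagorean theorem; the uniform bound on the partial sums
  carries it over to the series by dominated convergence.\<close>
lemma sums_integral_square:
  fixes f :: "nat \<Rightarrow> 'a \<Rightarrow> real"
  assumes A: "A \<in> sets M" "emeasure M A < \<infinity>"
    and b: "summable b" "\<And>n z. \<bar>f n z\<bar> \<le> b n * indicator A z"
    and int: "\<And>m n. integrable M (\<lambda>z. f m z * f n z)"
    and meas [measurable]: "\<And>n. f n \<in> borel_measurable M"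
    and orth: "\<And>m n. m \<noteq> n \<Longrightarrow> (\<integral>z. f m z * f n z \<partial>M) = 0"
  shows "(\<lambda>n. \<integral>z. (f n z)\<^sup>2 \<partial>M) sums (\<integral>z. (\<Sum>n. f n z)\<^sup>2 \<partial>M)"
proof -
  have sf: "summable (\<lambda>n. f n z)" for z
    using b by (intro summable_comparison_test'[OF summable_mult2[OF b(1)], of 0 _ "indicator A z"]) auto
  have bnn: "0 \<le> b n * indicator A z" for n z using order_trans[OF abs_ge_zero b(2)] .
  have bound: "\<bar>\<Sum>n<N. f n z\<bar> \<le> suminf b * indicator A z" for N z
  proof -
    have "\<bar>\<Sum>n<N. f n z\<bar> \<le> (\<Sum>n<N. b n * indicator A z)"
      using b(2) by (intro order_trans[OF sum_abs] sum_mono) auto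
    also have "\<dots> \<le> (\<Sum>n. b n * indicator A z)"
      using bnn by (intro sum_le_suminf summable_mult2 b) auto
    also have "\<dots> = suminf b * indicator A z" by (simp add: suminf_mult2[OF b(1)])
    finally show ?thesis .
  qed
  have partial: "(\<integral>z. (\<Sum>n<N. f n z)\<^sup>2 \<partial>M) = (\<Sum>n<N. \<integral>z. (f n z)\<^sup>2 \<partial>M)" for N
  proof -
    have "(\<integral>z. (\<Sum>n<N. f n z)\<^sup>2 \<partial>M) = (\<integral>z. (\<Sum>m<N. \<Sum>n<N. f m z * f n z) \<partial>M)"
      by (simp add: power2_eq_square sum_product)
    also have "\<dots> = (\<Sum>m<N. \<Sum>n<N. \<integral>z. f m z * f n z \<partial>M)"
      by (simp add: int)
    also have "\<dots> = (\<Sum>m<N. \<Sum>n<N. if m = n then \<integral>z. (f n z)\<^sup>2 \<partial>M else 0)"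
      by (intro sum.cong refl) (auto simp: orth power2_eq_square)
    finally show ?thesis by simp
  qed
  have "(\<lambda>N. \<integral>z. (\<Sum>n<N. f n z)\<^sup>2 \<partial>M) \<longlonglongrightarrow> (\<integral>z. (\<Sum>n. f n z)\<^sup>2 \<partial>M)"
  proof (rule integral_dominated_convergence)
    show "integrable M (\<lambda>z. (suminf b)\<^sup>2 * indicator A z)"
      using A by (intro integrable_mult_right integrable_real_indicator) auto
    show "AE z in M. (\<lambda>N. (\<Sum>n<N. f n z)\<^sup>2) \<longlonglongrightarrow> (\<Sum>n. f n z)\<^sup>2"
      using summable_LIMSEQ[OF sf] by (intro AE_I2 tendsto_power) auto
    show "AE z in M. norm ((\<Sum>n<N. f n z)\<^sup>2) \<le> (suminf b)\<^sup>2 * indicator A z" for N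
    proof (rule AE_I2)
      fix z show "norm ((\<Sum>n<N. f n z)\<^sup>2) \<le> (suminf b)\<^sup>2 * indicator A z"
        using power_mono[OF bound[where N = N and z = z] abs_ge_zero, of 2]
        by (cases "z \<in> A") (auto simp: power2_eq_square)
    qed
  qed measurable
  then show ?thesis unfolding sums_def partial .
qed

text \<open>A single term of the exponential series is below its sum.\<close>
lemma power_over_fact_le_exp:
  fixes y :: real assumes "y \<ge> 0" shows "y ^ m / fact m \<le> exp y"
proof -
  have "(\<Sum>n\<in>{m}. inverse (fact n) * y ^ n) \<le> (\<Sum>n. inverse (fact n) * y ^ n)"
    using assms by (intro sum_le_suminf summable_exp) auto
  then show ?thesis by (simp add: exp_def field_simps)
qed

lemma infsum_nat_eq_suminf:
  fixes f :: "nat \<Rightarrow> real"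
  assumes "f summable_on UNIV"
  shows "infsum f UNIV = suminf f"
  using has_sum_imp_sums[OF has_sum_infsum[OF assms]] by (simp add: sums_iff)

section \<open>Summability of the damped weights\<close>

text \<open>The height \<open>2 powi j\<close> of \<open>h * h\<close> for a Haar function \<open>h\<close> of level \<open>j\<close>, damped by the diffusion at time \<open>t\<close>.\<close>
definition heat_weight :: "real \<Rightarrow> real \<Rightarrow> int \<Rightarrow> real" where
  "heat_weight s t j = 2 powi j * exp (- t * 2 powr (s * real_of_int j))"

lemma heat_weight_pos: "heat_weight s t j > 0"
  by (simp add: heat_weight_def)

text \<open>The exponent of the damping factor grows geometrically. Bounding \<open>exp (- y)\<close> by \<open>fact m / y ^ m\<close> with
  \<open>m\<close> at least \<open>2 / s\<close> gives decay like \<open>4 ^ (- n)\<close>, which beats the factor \<open>2 ^ n\<close>.\<close>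
lemma summable_heat_weight_nat:
  assumes "s > 0" "t > 0"
  shows "summable (\<lambda>n. heat_weight s t (J + int n))"
proof -
  define m where "m = nat \<lceil>2 / s\<rceil>"
  have m: "s * real m \<ge> 2" using assms unfolding m_def
    by (metis mult.commute pos_divide_le_eq real_nat_ceiling_ge)
  define A where "A = t * 2 powr (s * J)"
  have A: "A > 0" using assms by (simp add: A_def)
  \<comment> \<open>the constants collected from \<open>exp (- y) \<le> fact m / y ^ m\<close> with \<open>y = A * 2 powr (s * n)\<close>\<close>
  define C where "C = 2 powi J * fact m / A ^ m"
  have "norm (heat_weight s t (J + int n)) \<le> C * (1 / 2) ^ n" for n
  proof -
    define y where "y = A * 2 powr (s * n)"
    have y: "y > 0" using A by (simp add: y_def)
    have "A ^ m * 4 ^ n \<le> y ^ m"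
    proof -
      have "(4::real) ^ n = 2 powr (2 * n)" by (simp add: powr_powr[symmetric] powr_realpow)
      also have "\<dots> \<le> 2 powr (s * real m * n)" using m by (intro powr_mono) (auto intro: mult_right_mono)
      also have "\<dots> = (2 powr (s * n)) ^ m" by (simp add: powr_powr mult_ac flip: powr_realpow)
      finally show ?thesis using A by (simp add: y_def power_mult_distrib)
    qed
    then have "A ^ m * 4 ^ n / fact m \<le> exp y"
      using power_over_fact_le_exp[of y m] y by (smt (verit) divide_right_mono fact_ge_zero)
    then have "exp (- y) \<le> fact m / A ^ m * (1 / 4) ^ n"
      using A by (simp add: exp_minus field_simps)
    then have "2 powi J * 2 ^ n * exp (- y) \<le> 2 powi J * 2 ^ n * (fact m / A ^ m * (1 / 4) ^ n)"
      by (intro mult_left_mono) auto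
    also have "\<dots> = C * (2 * (1 / 4)) ^ n"
      unfolding C_def by (simp only: power_mult_distrib) (simp add: mult_ac)
    finally show ?thesis
      by (simp add: heat_weight_def y_def A_def power_int_add ring_distribs powr_add mult_ac)
  qed
  then show ?thesis
    by (intro summable_comparison_test'[OF summable_mult[OF summable_geometric]]) auto
qed

text \<open>At negative levels the factor \<open>2 powi j\<close> alone is summable.\<close>
lemma summable_on_heat_weight:
  assumes "s > 0" "t > 0"
  shows "heat_weight s t summable_on UNIV"
proof -
  have inj: "inj_on int UNIV" "inj_on (\<lambda>n. - int n) UNIV" by (auto simp: inj_on_def)
  have "heat_weight s t summable_on range int"
    unfolding summable_on_reindex[OF inj(1)]
    using summable_heat_weight_nat[OF assms, of 0]
    by (intro summable_nonneg_imp_summable_on) (auto simp: heat_weight_def comp_def)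
  moreover have "heat_weight s t summable_on range (\<lambda>n. - int n)"
    unfolding summable_on_reindex[OF inj(2)]
  proof (intro summable_nonneg_imp_summable_on)
    have "norm ((heat_weight s t \<circ> (\<lambda>n. - int n)) n) \<le> (1 / 2) ^ n" for n
      using assms by (simp add: heat_weight_def power_int_minus field_simps)
    then show "summable (heat_weight s t \<circ> (\<lambda>n. - int n))"
      by (intro summable_comparison_test'[OF summable_geometric]) auto
  qed (auto simp: heat_weight_def)
  ultimately have "heat_weight s t summable_on (range int \<union> range (\<lambda>n. - int n))"
    by (rule summable_on_union)
  also have "range int \<union> range (\<lambda>n. - int n) = UNIV"
    by (auto simp: image_iff) (metis int_cases2)
  finally show ?thesis .
qed

section \<open>The kernel level by level\<close>

text \<open>For \<open>x \<ge> 0\<close>, the sum of \<open>h x * h z\<close> over the Haar functions of level \<open>j\<close>: only the one whose support contains \<open>x\<close>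
  contributes.\<close>
definition level_kernel :: "int \<Rightarrow> real \<Rightarrow> real \<Rightarrow> real" where
  "level_kernel j x z = haar j (nat (cell j x)) x * haar j (nat (cell j x)) z"

lemma diffusion_kernel_eq_levels:
  assumes "x \<ge> 0"
  shows "diffusion_kernel s t x z =
    (\<Sum>\<^sub>\<infinity>j. exp (- t * 2 powr (s * real_of_int j)) * level_kernel j x z)"
proof -
  let ?g = "\<lambda>(j, k). exp (- t * measure lborel (dyadic_interval j k) powr (- s)) * haar j k x * haar j k z"
  let ?i = "\<lambda>j. (j, nat (cell j x))"
  have "diffusion_kernel s t x z = infsum ?g (range ?i)"
    unfolding diffusion_kernel_def
  proof (rule infsum_cong_neutral)
    fix p assume "p \<in> UNIV - range ?i"
    moreover obtain j k where p: "p = (j, k)" by force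
    ultimately have "cell j x \<noteq> int k" using cell_nonneg[OF assms, of j] by auto
    then show "?g p = 0" by (simp add: p haar_eq_0)
  qed auto
  also have "\<dots> = infsum (?g \<circ> ?i) UNIV"
    by (rule infsum_reindex) (auto simp: inj_on_def)
  also have "\<dots> = (\<Sum>\<^sub>\<infinity>j. exp (- t * 2 powr (s * real_of_int j)) * level_kernel j x z)"
  proof (rule infsum_cong)
    fix j
    have "(2 powi (- j) :: real) powr (- s) = 2 powr (s * real_of_int j)"
      by (simp add: powr_powr mult.commute flip: powr_real_of_int')
    then show "(?g \<circ> ?i) j = exp (- t * 2 powr (s * real_of_int j)) * level_kernel j x z"
      by (simp add: level_kernel_def)
  qed
  finally show ?thesis .
qed

lemma abs_level_kernel_le: "\<bar>level_kernel j x z\<bar> \<le> 2 powi j"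
proof -
  let ?h = "haar j (nat (cell j x))"
  have "\<bar>?h x\<bar> * \<bar>?h z\<bar> \<le> 2 powr (real_of_int j / 2) * 2 powr (real_of_int j / 2)"
    by (intro mult_mono abs_haar_le) auto
  also have "\<dots> = 2 powi j"
    by (simp flip: powr_add powr_real_of_int')
  finally show ?thesis by (simp add: level_kernel_def abs_mult)
qed

lemma level_kernel_borel [measurable]: "level_kernel j x \<in> borel_measurable borel"
  unfolding level_kernel_def[abs_def] by measurable

lemma summable_on_levels:
  assumes "s > 0" "t > 0"
  shows "(\<lambda>j. exp (- t * 2 powr (s * real_of_int j)) * level_kernel j x z) summable_on UNIV"
proof (rule abs_summable_summable,
    rule Infinite_Sum.abs_summable_on_comparison_test'[OF summable_on_heat_weight[OF assms]])
  fix j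
  show "norm (exp (- t * 2 powr (s * real_of_int j)) * level_kernel j x z) \<le> heat_weight s t j"
    using abs_level_kernel_le[of j x z]
    by (simp add: heat_weight_def abs_mult mult.commute[of "2 powi j"])
qed

lemma level_kernel_coarse:
  assumes "j < J" "cell J x = cell J y"
  shows "level_kernel j x z = level_kernel j y z"
  using haar_coarse_const[OF assms] cell_coarsen[of j J x y] assms
  by (simp add: level_kernel_def)

lemma level_kernel_eq_0:
  assumes "x \<ge> 0" "J \<le> j" "cell J z \<noteq> cell J x"
  shows "level_kernel j x z = 0"
proof -
  have "cell j z \<noteq> cell j x"
    using cell_coarsen[OF assms(2), of z x] assms(3) by blast
  then have "cell j z \<noteq> int (nat (cell j x))"
    using cell_nonneg[OF assms(1), of j] by simp
  then show ?thesis by (simp add: level_kernel_def haar_eq_0)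
qed

text \<open>The Haar functions of levels coarser than a common cell take the same values at \<open>x\<close> and \<open>y\<close> and cancel.
  The remaining levels are enumerated by natural numbers.\<close>
lemma kernel_difference_eq_suminf:
  assumes "s > 0" "t > 0" "x \<ge> 0" "y \<ge> 0" "cell J x = cell J y"
  shows "diffusion_kernel s t x z - diffusion_kernel s t y z =
    (\<Sum>n. exp (- t * 2 powr (s * real_of_int (J + int n))) *
          (level_kernel (J + int n) x z - level_kernel (J + int n) y z))"
proof -
  let ?c = "\<lambda>j. exp (- t * 2 powr (s * real_of_int j))"
  let ?f = "\<lambda>j. ?c j * (level_kernel j x z - level_kernel j y z)"
  let ?i = "\<lambda>n. J + int n"
  have inj: "inj_on ?i UNIV" by (auto simp: inj_on_def)
  have "((\<lambda>j. ?c j * level_kernel j x z + - (?c j * level_kernel j y z)) has_sum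
      diffusion_kernel s t x z + - diffusion_kernel s t y z) UNIV"
    unfolding diffusion_kernel_eq_levels[OF assms(3)] diffusion_kernel_eq_levels[OF assms(4)]
    by (intro has_sum_add has_sum_uminusI has_sum_infsum summable_on_levels assms(1,2))
  then have has_sum: "(?f has_sum diffusion_kernel s t x z - diffusion_kernel s t y z) UNIV"
    by (simp add: right_diff_distrib)
  then have f: "?f summable_on UNIV" by (rule has_sum_imp_summable)
  have "diffusion_kernel s t x z - diffusion_kernel s t y z = infsum ?f UNIV"
    using has_sum by (rule infsumI[symmetric])
  also have "\<dots> = infsum ?f (range ?i)"
  proof (rule infsum_cong_neutral)
    fix j assume j: "j \<in> UNIV - range ?i"
    have "j \<in> range ?i" if "J \<le> j" using that by (intro range_eqI[of _ _ "nat (j - J)"]) simp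
    then have "j < J" using j by auto
    then show "?f j = 0" using level_kernel_coarse[OF _ assms(5)] by simp
  qed auto
  also have "\<dots> = infsum (?f \<circ> ?i) UNIV" by (rule infsum_reindex[OF inj])
  also have "\<dots> = suminf (?f \<circ> ?i)"
    using summable_on_subset_banach[OF f, of "range ?i"]
    by (intro infsum_nat_eq_suminf) (simp add: summable_on_reindex[OF inj])
  finally show ?thesis by (simp add: comp_def)
qed

lemma integral_haar_combination:
  fixes a b a' b' :: real and i j :: int and p q p' q' :: nat
  defines "f \<equiv> \<lambda>z. (a * haar i p z - b * haar i q z) * (a' * haar j p' z - b' * haar j q' z)"
  shows "integrable lborel f"
    and "integral\<^sup>L lborel f = (if i = j then a * (a' * of_bool (p = p') - b' * of_bool (p = q'))
           - b * (a' * of_bool (q = p') - b' * of_bool (q = q')) else 0)"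
proof -
  have f: "f = (\<lambda>z. a * (a' * (haar i p z * haar j p' z) - b' * (haar i p z * haar j q' z))
      - b * (a' * (haar i q z * haar j p' z) - b' * (haar i q z * haar j q' z)))"
    unfolding f_def by (simp add: algebra_simps)
  show "integrable lborel f"
    unfolding f by (simp add: haar_orthonormal(1))
  show "integral\<^sup>L lborel f = (if i = j then a * (a' * of_bool (p = p') - b' * of_bool (p = q'))
           - b * (a' * of_bool (q = p') - b' * of_bool (q = q')) else 0)"
    unfolding f by (simp add: haar_orthonormal)
qed

lemma level_kernel_difference_orthogonal:
  shows "integrable lborel (\<lambda>z. (level_kernel i x z - level_kernel i y z) * 
           (level_kernel j x z - level_kernel j y z))"
    and "i \<noteq> j \<Longrightarrow> (\<integral>z. (level_kernel i x z - level_kernel i y z) * 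
           (level_kernel j x z - level_kernel j y z) \<partial>lborel) = 0"
  unfolding level_kernel_def by (simp_all add: integral_haar_combination)

text \<open>At the splitting level one Haar function \<open>h\<close> sees both points, with opposite signs, so that
  \<open>(h x - h y)\<^sup>2 = 4 * 2 powi J\<close>. At a finer level two different Haar functions see one point each, and
  their squares \<open>2 powi j\<close> add up.\<close>
lemma integral_level_kernel_difference:
  assumes "x \<ge> 0" "y \<ge> 0" and J: "\<And>j. cell j x = cell j y \<longleftrightarrow> j \<le> J" and "J \<le> j"
  shows "(\<integral>z. (level_kernel j x z - level_kernel j y z)\<^sup>2 \<partial>lborel) = (if j = J then 4 else 2) * 2 powi j"
proof -
  let ?p = "nat (cell j x)" and ?q = "nat (cell j y)"
  let ?a = "haar j ?p x" and ?b = "haar j ?q y"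
  have sq: "?a * ?a = 2 powi j" "?b * ?b = 2 powi j"
    using assms cell_nonneg by (simp_all add: haar_square mem_dyadic_interval_iff)
  have int: "(\<integral>z. (level_kernel j x z - level_kernel j y z)\<^sup>2 \<partial>lborel)
     = ?a * (?a - ?b * of_bool (?p = ?q)) - ?b * (?a * of_bool (?q = ?p) - ?b)"
    unfolding level_kernel_def power2_eq_square by (simp add: integral_haar_combination)
  show ?thesis
  proof (cases "j = J")
    case True
    then have pq: "?p = ?q" using J[of j] by simp
    have "cell (j + 1) x \<noteq> cell (j + 1) y" using J[of "j + 1"] True by simp
    \<comment> \<open>the points lie in different halves of the support\<close>
    then have "?b = - ?a"
      using cell_child[of j x] cell_child[of j y] J[of j] True cell_nonneg[OF assms(1), of j]
      by (auto simp: haar_eq_cell)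
    then show ?thesis unfolding int using pq sq True by (simp add: algebra_simps)
  next
    case False
    then have "cell j x \<noteq> cell j y" using J[of j] assms(4) by simp
    then have "?p \<noteq> ?q" using cell_nonneg assms by (simp add: eq_nat_nat_iff)
    then show ?thesis unfolding int using sq False by simp
  qed
qed

section \<open>The diffusion distance in terms of the splitting level\<close>

definition heat_tail :: "real \<Rightarrow> real \<Rightarrow> int \<Rightarrow> real" where
  "heat_tail s t J = (\<Sum>n. heat_weight s t (J + int n))"

text \<open>The squared diffusion distance of two points with splitting level \<open>J\<close>, for time \<open>t / 2\<close>: since the
  square doubles the exponents, the distance at time \<open>t\<close> uses \<open>gap_energy s (2 * t)\<close>. The tail counts
  the levels from \<open>J\<close> on with weight 2, and the extra summand raises the weight of level \<open>J\<close> to 4.\<close>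
definition gap_energy :: "real \<Rightarrow> real \<Rightarrow> int \<Rightarrow> real" where
  "gap_energy s t J = 2 * (heat_weight s t J + heat_tail s t J)"

lemma heat_tail_rec:
  assumes "s > 0" "t > 0"
  shows "heat_tail s t J = heat_weight s t J + heat_tail s t (J + 1)"
  using suminf_split_head[OF summable_heat_weight_nat[OF assms, of J]]
  by (simp add: heat_tail_def add_ac)

lemma heat_tail_nonneg: "s > 0 \<Longrightarrow> t > 0 \<Longrightarrow> heat_tail s t J \<ge> 0"
  unfolding heat_tail_def
  by (intro suminf_nonneg summable_heat_weight_nat less_imp_le[OF heat_weight_pos])

text \<open>Parseval's identity for the difference of the two kernel sections, whose Haar expansion starts at the
  splitting level and lives on the smallest common interval.\<close>
lemma set_integral_kernel_difference:
  assumes "s > 0" "t > 0" "x \<ge> 0" "y \<ge> 0" and J: "\<And>j. cell j x = cell j y \<longleftrightarrow> j \<le> J"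
  shows "(LINT z:{0..}|lborel. \<bar>diffusion_kernel s t x z - diffusion_kernel s t y z\<bar>\<^sup>2)
     = gap_energy s (2 * t) J"
proof -
  define c where "c n = exp (- t * 2 powr (s * real_of_int (J + int n)))" for n
  define g where "g n z = level_kernel (J + int n) x z - level_kernel (J + int n) y z" for n z
  define A where "A = dyadic_interval J (nat (cell J x))"
  have JJ: "cell J x = cell J y" using J by simp
  have supp: "g n z = 0" if "z \<notin> A" for n z
    using that cell_nonneg[OF assms(3), of J] assms(3,4) JJ
    by (auto simp: A_def g_def mem_dyadic_interval_iff level_kernel_eq_0[where J = J])
  have diff: "diffusion_kernel s t x z - diffusion_kernel s t y z = (\<Sum>n. c n * g n z)" for z
    unfolding c_def g_def by (rule kernel_difference_eq_suminf[OF assms(1-4) JJ])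
  have c2: "(c n)\<^sup>2 * 2 powi (J + int n) = heat_weight s (2 * t) (J + int n)" for n
    by (simp add: c_def heat_weight_def power2_eq_square mult_ac flip: exp_add)
  have norm: "(\<integral>z. (c n * g n z)\<^sup>2 \<partial>lborel) = 
      (if n = 0 then 4 else 2) * heat_weight s (2 * t) (J + int n)" for n
  proof -
    have "(\<integral>z. (c n * g n z)\<^sup>2 \<partial>lborel) = (c n)\<^sup>2 * (\<integral>z. (g n z)\<^sup>2 \<partial>lborel)"
      by (simp add: power_mult_distrib)
    also have "\<dots> = (c n)\<^sup>2 * ((if n = 0 then 4 else 2) * 2 powi (J + int n))"
      unfolding g_def using integral_level_kernel_difference[OF assms(3,4) J, of "J + int n"] by simp
    finally show ?thesis by (simp flip: c2)
  qed
  have "(\<lambda>n. \<integral>z. (c n * g n z)\<^sup>2 \<partial>lborel) sums (\<integral>z. (\<Sum>n. c n * g n z)\<^sup>2 \<partial>lborel)"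
  proof (rule sums_integral_square)
    show "A \<in> sets lborel" "emeasure lborel A < \<infinity>" by (simp_all add: A_def)
    show "summable (\<lambda>n. 2 * heat_weight s t (J + int n))"
      by (intro summable_mult summable_heat_weight_nat assms)
    show "\<bar>c n * g n z\<bar> \<le> 2 * heat_weight s t (J + int n) * indicator A z" for n z
    proof (cases "z \<in> A")
      case True
      have "\<bar>g n z\<bar> \<le> 2 * 2 powi (J + int n)"
        using abs_level_kernel_le[of "J + int n" x z] abs_level_kernel_le[of "J + int n" y z]
        unfolding g_def by linarith
      then have "c n * \<bar>g n z\<bar> \<le> c n * (2 * 2 powi (J + int n))"
        by (intro mult_left_mono) (auto simp: c_def)
      then show ?thesis using True by (simp add: abs_mult heat_weight_def c_def mult_ac)
    qed (simp add: supp)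
    show "(\<lambda>z. c n * g n z) \<in> borel_measurable lborel" for n
      unfolding g_def[abs_def] by measurable
    show "integrable lborel (\<lambda>z. c m * g m z * (c n * g n z))" for m n
    proof -
      have "integrable lborel (\<lambda>z. c m * c n * (g m z * g n z))"
        unfolding g_def by (intro integrable_mult_right level_kernel_difference_orthogonal)
      then show ?thesis by (simp add: mult_ac)
    qed
    show "(\<integral>z. c m * g m z * (c n * g n z) \<partial>lborel) = 0" if "m \<noteq> n" for m n
    proof -
      have "(\<integral>z. c m * c n * (g m z * g n z) \<partial>lborel) = 0"
        unfolding g_def using that
        by (subst integral_mult_right_zero) (simp add: level_kernel_difference_orthogonal)
      then show ?thesis by (simp add: mult_ac)
    qed
  qed
  moreover have "(\<lambda>n. (if n = 0 then 4 else 2) * heat_weight s (2 * t) (J + int n)) sums gap_energy s (2 * t) J"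
  proof -
    have "(\<lambda>n. 2 * heat_weight s (2 * t) (J + int n)) sums (2 * heat_tail s (2 * t) J)"
      unfolding heat_tail_def using assms(1,2) by (intro sums_mult summable_sums summable_heat_weight_nat) auto
    moreover have "(\<lambda>n. if n = 0 then 2 * heat_weight s (2 * t) J else 0) sums (2 * heat_weight s (2 * t) J)"
      using sums_single[of 0 "\<lambda>_. 2 * heat_weight s (2 * t) J"] by simp
    ultimately have "(\<lambda>n. (if n = 0 then 2 * heat_weight s (2 * t) J else 0) + 2 * heat_weight s (2 * t) (J + int n))
        sums (2 * heat_weight s (2 * t) J + 2 * heat_tail s (2 * t) J)"
      by (rule sums_add[rotated])
    moreover have "(if n = 0 then 2 * heat_weight s (2 * t) J else 0) + 2 * heat_weight s (2 * t) (J + int n)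
        = (if n = 0 then 4 else 2) * heat_weight s (2 * t) (J + int n)" for n by simp
    ultimately show ?thesis by (simp add: gap_energy_def)
  qed
  ultimately have "(\<integral>z. (\<Sum>n. c n * g n z)\<^sup>2 \<partial>lborel) = gap_energy s (2 * t) J"
    unfolding norm by (rule sums_unique2)
  moreover have "(LINT z:{0..}|lborel. \<bar>diffusion_kernel s t x z - diffusion_kernel s t y z\<bar>\<^sup>2)
      = (\<integral>z. (\<Sum>n. c n * g n z)\<^sup>2 \<partial>lborel)"
    unfolding set_lebesgue_integral_def
  proof (rule Bochner_Integration.integral_cong)
    fix z :: real
    have "z \<notin> A" if "z < 0" 
      using that cell_nonneg_iff[of J z] by (auto simp: A_def mem_dyadic_interval_iff)
    then show "indicator {0..} z *\<^sub>R \<bar>diffusion_kernel s t x z - diffusion_kernel s t y z\<bar>\<^sup>2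
        = (\<Sum>n. c n * g n z)\<^sup>2"
      unfolding diff by (cases "z < 0") (auto simp: supp)
  qed simp
  ultimately show ?thesis by simp
qed

lemma diffusion_dist_splitting_level:
  assumes "s > 0" "t > 0" "x \<ge> 0" "y \<ge> 0" and J: "\<And>j. cell j x = cell j y \<longleftrightarrow> j \<le> J"
  shows "diffusion_dist s t x y = sqrt (gap_energy s (2 * t) J)"
  unfolding diffusion_dist_def set_integral_kernel_difference[OF assms] ..

lemma diffusion_dist_self: "diffusion_dist s t x x = 0"
  by (simp add: diffusion_dist_def set_lebesgue_integral_def)

text \<open>Up to the factor \<open>2 powi (- J)\<close>, the series in \<open>diffusion_eta\<close> is the tail of the weights from level
  \<open>J\<close> on; its summand for index 0 is doubled.\<close>
lemma diffusion_psi_dyadic: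
  assumes "s > 0" "t > 0"
  shows "diffusion_psi s t (2 powi (- J)) = sqrt (gap_energy s (2 * t) J)"
proof -
  have u: "(2 powi (- J) :: real) powr (- s) = 2 powr (s * real_of_int J)"
    by (simp add: powr_powr mult.commute flip: powr_real_of_int')
  have weight: "2 powi J * (2 ^ l * exp (- 2 * t * 2 powr (s * real l) * 2 powr (s * real_of_int J)))
      = heat_weight s (2 * t) (J + int l)" for l
    by (simp add: heat_weight_def power_int_add ring_distribs powr_add mult_ac)
  define f where "f l = 2 ^ l * exp (- 2 * t * 2 powr (s * real l) * 2 powr (s * real_of_int J))" for l :: nat
  have f: "f l = 2 powi (- J) * heat_weight s (2 * t) (J + int l)" for l
    unfolding weight[symmetric] f_def by (simp add: power_int_minus)
  have summ: "summable f"
    unfolding f using assms by (intro summable_mult summable_heat_weight_nat) auto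
  have "infsum f {1..} = infsum (f \<circ> Suc) UNIV"
  proof -
    have "{1..} = range Suc" by (auto simp: image_iff Suc_le_eq gr0_conv_Suc)
    then show ?thesis by (simp add: infsum_reindex)
  qed
  also have "\<dots> = (\<Sum>n. f (Suc n))"
    using summ summable_Suc_iff[of f]
    by (subst infsum_nat_eq_suminf) (auto simp: comp_def f_def intro!: summable_nonneg_imp_summable_on)
  also have "\<dots> = suminf f - f 0" by (rule suminf_split_head[OF summ])
  also have "suminf f = 2 powi (- J) * heat_tail s (2 * t) J"
    unfolding f heat_tail_def using assms
    by (intro suminf_mult summable_heat_weight_nat) auto
  finally have "diffusion_eta s t (2 powr (s * real_of_int J)) = f 0 + 2 powi (- J) * heat_tail s (2 * t) J"
    unfolding diffusion_eta_def f_def by simp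
  also have "\<dots> = 2 powi (- J) * (heat_weight s (2 * t) J + heat_tail s (2 * t) J)"
    by (simp add: f ring_distribs)
  finally show ?thesis
    unfolding diffusion_psi_def u gap_energy_def by simp
qed

section \<open>Monotonicity and the balls\<close>

text \<open>Moving the splitting one level down replaces \<open>4 * w J + 2 * w (J + 1)\<close> by \<open>4 * w (J + 1)\<close>, where
  \<open>w\<close> stands for the weights. This is a loss because the damping factor decreases strictly in the level,
  so that \<open>w (J + 1) < 2 * w J\<close>. The weights themselves need not be monotone.\<close>
lemma gap_energy_strict_mono:
  assumes "s > 0" "t > 0"
  shows "gap_energy s t (J + 1) < gap_energy s t J"
proof -
  have "exp (- t * 2 powr (s * real_of_int (J + 1))) < exp (- t * 2 powr (s * real_of_int J))"
    using assms by simp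
  then have "heat_weight s t (J + 1) < 2 * heat_weight s t J"
    by (simp add: heat_weight_def power_int_add)
  then show ?thesis
    using heat_tail_rec[OF assms, of J] by (simp add: gap_energy_def)
qed

lemma gap_energy_less_iff:
  assumes "s > 0" "t > 0"
  shows "gap_energy s t i < gap_energy s t j \<longleftrightarrow> j < i"
proof -
  have less: "gap_energy s t i < gap_energy s t j" if "j < i" for i j
    using that
  proof (induction i rule: int_gr_induct)
    case base then show ?case by (rule gap_energy_strict_mono[OF assms])
  next
    case (step i) then show ?case using gap_energy_strict_mono[OF assms, of i] by linarith
  qed
  show ?thesis using less[of i j] less[of j i] by (cases i j rule: linorder_cases) auto
qed

lemma gap_energy_pos:
  assumes "s > 0" "t > 0"
  shows "gap_energy s t J > 0"
  using heat_weight_pos[of s t J] heat_tail_nonneg[OF assms, of J] by (simp add: gap_energy_def)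

lemma gap_energy_le_tail:
  assumes "s > 0" "t > 0"
  shows "gap_energy s t J \<le> 4 * heat_tail s t J"
  using heat_tail_rec[OF assms, of J] heat_tail_nonneg[OF assms, of "J + 1"]
  by (simp add: gap_energy_def)

lemma gap_energy_small:
  assumes "s > 0" "t > 0" "e > 0"
  shows "\<exists>J. gap_energy s t J < e"
proof -
  obtain N where "norm (\<Sum>i. heat_weight s t (0 + int (i + N))) < e / 4"
    using suminf_exist_split[OF _ summable_heat_weight_nat[OF assms(1,2), of 0], of "e / 4"] assms(3) by auto
  then have "heat_tail s t (int N) < e / 4"
    by (simp add: heat_tail_def add_ac)
  then show ?thesis using gap_energy_le_tail[OF assms(1,2), of "int N"] by (intro exI[of _ "int N"]) linarith
qed

text \<open>At very coarse levels the energy stays below a multiple of the sum of all weights. This is the reason why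
  balls of large radius exhaust the half-line.\<close>
lemma gap_energy_bounded:
  assumes "s > 0" "t > 0"
  shows "gap_energy s t J \<le> 4 * infsum (heat_weight s t) UNIV"
proof -
  let ?i = "\<lambda>n. J + int n"
  have inj: "inj_on ?i UNIV" by (auto simp: inj_on_def)
  have sub: "heat_weight s t summable_on range ?i"
    by (rule summable_on_subset_banach[OF summable_on_heat_weight[OF assms]]) simp
  have "heat_tail s t J = infsum (heat_weight s t \<circ> ?i) UNIV"
    unfolding heat_tail_def using sub
    by (subst infsum_nat_eq_suminf) (simp_all add: summable_on_reindex[OF inj] comp_def)
  also have "\<dots> = infsum (heat_weight s t) (range ?i)" by (rule infsum_reindex[OF inj, symmetric])
  also have "\<dots> \<le> infsum (heat_weight s t) UNIV"
    by (intro infsum_mono_neutral sub summable_on_heat_weight assms)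
       (auto intro: less_imp_le[OF heat_weight_pos])
  finally show ?thesis using gap_energy_le_tail[OF assms, of J] by linarith
qed

text \<open>By strict monotonicity, a distance below the value at level \<open>j\<close> means a splitting level beyond \<open>j\<close>,
  that is, a common interval of level \<open>j + 1\<close>.\<close>
lemma diffusion_dist_less_iff:
  assumes "s > 0" "t > 0" "x \<ge> 0" "y \<ge> 0"
  shows "diffusion_dist s t x y < sqrt (gap_energy s (2 * t) j) \<longleftrightarrow> cell (j + 1) y = cell (j + 1) x"
proof (cases "x = y")
  case True
  then show ?thesis using assms gap_energy_pos[of s "2 * t" j] by (simp add: diffusion_dist_self)
next
  case False
  then obtain J where J: "\<And>i. cell i x = cell i y \<longleftrightarrow> i \<le> J"
    using splitting_level assms by metis
  have "diffusion_dist s t x y < sqrt (gap_energy s (2 * t) j) \<longleftrightarrow> j < J"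
    using assms by (simp add: diffusion_dist_splitting_level[OF assms J] gap_energy_less_iff)
  then show ?thesis using J[of "j + 1"] by auto
qed

lemma diffusion_dist_range:
  assumes "s > 0" "t > 0" "x \<ge> 0" "y \<ge> 0"
  shows "diffusion_dist s t x y = 0 \<or> (\<exists>i. diffusion_dist s t x y = sqrt (gap_energy s (2 * t) i))"
  by (metis assms splitting_level diffusion_dist_splitting_level diffusion_dist_self)

lemma diffusion_ball_threshold:
  assumes "s > 0" "t > 0" "x \<ge> 0"
  shows "diffusion_ball s t x (sqrt (gap_energy s (2 * t) j)) = dyadic_interval (j + 1) (nat (cell (j + 1) x))"
proof (rule set_eqI)
  fix y
  have "y \<in> dyadic_interval (j + 1) (nat (cell (j + 1) x)) \<longleftrightarrow> cell (j + 1) y = cell (j + 1) x"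
    using cell_nonneg[OF assms(3)] by (simp add: mem_dyadic_interval_iff)
  moreover have "y \<ge> 0" if "cell (j + 1) y = cell (j + 1) x"
    using that cell_nonneg[OF assms(3), of "j + 1"] cell_nonneg_iff[of "j + 1" y] by simp
  ultimately show "y \<in> diffusion_ball s t x (sqrt (gap_energy s (2 * t) j)) \<longleftrightarrow>
      y \<in> dyadic_interval (j + 1) (nat (cell (j + 1) x))"
    using diffusion_dist_less_iff[OF assms] by (auto simp: diffusion_ball_def)
qed

text \<open>The distances from \<open>x\<close> are 0 or values of the decreasing sequence \<open>sqrt (gap_energy s (2 * t) i)\<close>, which
  tends to 0 as \<open>i\<close> grows. A radius above all these values gives the half-line. Any other radius can be
  raised to the next value of the sequence without changing the ball.\<close>
lemma diffusion_ball_cases: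
  assumes "s > 0" "t > 0" "x \<ge> 0" "r > 0"
  shows "diffusion_ball s t x r = {0..} \<or> diffusion_ball s t x r \<in> dyadic_intervals"
proof (cases "\<forall>i. sqrt (gap_energy s (2 * t) i) < r")
  case True
  then have "diffusion_ball s t x r = {0..}"
    using diffusion_dist_range[OF assms(1-3)] assms(4) by (fastforce simp: diffusion_ball_def)
  then show ?thesis ..
next
  case False
  let ?\<phi> = "\<lambda>i. sqrt (gap_energy s (2 * t) i)"
  have t2: "2 * t > 0" using assms by simp
  have \<phi>: "?\<phi> i < ?\<phi> j \<longleftrightarrow> j < i" for i j
    using gap_energy_less_iff[OF assms(1) t2] by simp
  obtain i where i: "r \<le> ?\<phi> i" using False by (meson not_less)
  obtain N where "gap_energy s (2 * t) N < r\<^sup>2"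
    using gap_energy_small[OF assms(1) t2, of "r\<^sup>2"] assms(4) by auto
  then have N: "?\<phi> N < r" using assms(4) by (simp add: real_less_lsqrt)
  have "i \<le> N" using i N \<phi>[of N i] by linarith
  then obtain j where "r \<le> ?\<phi> j" "\<not> r \<le> ?\<phi> (j + 1)"
    using int_last_before_change[of "\<lambda>i. r \<le> ?\<phi> i" i N] i N by force
  then have j: "r \<le> ?\<phi> j" "?\<phi> (j + 1) < r" by simp_all
  have "diffusion_dist s t x y < r \<longleftrightarrow> diffusion_dist s t x y < ?\<phi> j" if "y \<ge> 0" for y
    using diffusion_dist_range[OF assms(1-3) that]
  proof
    assume "diffusion_dist s t x y = 0"
    then show ?thesis using j assms(4) by linarith
  next
    assume "\<exists>i. diffusion_dist s t x y = ?\<phi> i"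
    then obtain i where "diffusion_dist s t x y = ?\<phi> i" ..
    then show ?thesis using j \<phi>[of i j] \<phi>[of "j + 1" i] \<phi>[of i "j + 1"] by linarith
  qed
  then have "diffusion_ball s t x r = diffusion_ball s t x (?\<phi> j)"
    by (auto simp: diffusion_ball_def)
  then show ?thesis
    using diffusion_ball_threshold[OF assms(1-3)] by (auto simp: dyadic_intervals_def)
qed

text \<open>The centre is the left endpoint, the radius the smallest distance to a point outside.\<close>
lemma dyadic_interval_is_ball:
  assumes "s > 0" "t > 0"
  shows "\<exists>x r. dyadic_interval j k = diffusion_ball s t x r \<and> x \<ge> 0 \<and> r > 0"
proof -
  define x :: real where "x = real k * 2 powi (- j)"
  have x: "x \<ge> 0" "cell j x = int k"
    unfolding x_def cell_def by (simp_all add: power_int_minus mult.left_commute[of "2 powi j"])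
  then have "dyadic_interval j k = diffusion_ball s t x (sqrt (gap_energy s (2 * t) (j - 1)))"
    using diffusion_ball_threshold[OF assms x(1), of "j - 1"] by simp
  moreover have "sqrt (gap_energy s (2 * t) (j - 1)) > 0"
    using gap_energy_pos[of s "2 * t"] assms by simp
  ultimately show ?thesis using x(1) by blast
qed

lemma halfline_is_ball:
  assumes "s > 0" "t > 0"
  shows "\<exists>x r. {0..} = diffusion_ball s t x r \<and> x \<ge> 0 \<and> r > 0"
proof -
  define R where "R = sqrt (4 * infsum (heat_weight s (2 * t)) UNIV) + 1"
  have R: "sqrt (gap_energy s (2 * t) i) < R" for i
  proof -
    have "sqrt (gap_energy s (2 * t) i) \<le> sqrt (4 * infsum (heat_weight s (2 * t)) UNIV)"
      using gap_energy_bounded[of s "2 * t" i] assms by (intro real_sqrt_le_mono) simp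
    then show ?thesis unfolding R_def by linarith
  qed
  have "R > 0" using R[of 0] gap_energy_pos[of s "2 * t" 0] assms
    by (meson order.strict_trans mult_pos_pos real_sqrt_gt_0_iff zero_less_numeral)
  have "diffusion_dist s t 0 y < R" if "y \<ge> 0" for y
    using diffusion_dist_range[OF assms, of 0 y] that R \<open>R > 0\<close> by auto
  then show ?thesis using \<open>R > 0\<close>
    by (intro exI[of _ 0] exI[of _ R]) (auto simp: diffusion_ball_def)
qed

theorem theorem3p2:
  fixes s t :: real
  assumes "s > 0" and "t > 0"
  shows "(\<forall>x\<ge>0. \<forall>y\<ge>0. diffusion_dist s t x y = diffusion_psi s t (dyadic_dist x y)) \<and>
         {diffusion_ball s t x r | x r. x \<ge> 0 \<and> r > 0} = dyadic_intervals \<union> {{0..}}"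
proof (intro conjI allI impI)
  fix x y :: real assume xy: "x \<ge> 0" "y \<ge> 0"
  show "diffusion_dist s t x y = diffusion_psi s t (dyadic_dist x y)"
  proof (cases "x = y")
    case True
    then show ?thesis using xy by (simp add: diffusion_dist_self dyadic_dist_self diffusion_psi_def)
  next
    case False
    then obtain J where J: "\<And>j. cell j x = cell j y \<longleftrightarrow> j \<le> J"
      using splitting_level xy by metis
    show ?thesis
      unfolding diffusion_dist_splitting_level[OF assms xy J] dyadic_dist_splitting_level[OF xy J]
      by (rule diffusion_psi_dyadic[OF assms, symmetric])
  qed
next
  show "{diffusion_ball s t x r | x r. x \<ge> 0 \<and> r > 0} = dyadic_intervals \<union> {{0..}}"
  proof
    show "{diffusion_ball s t x r | x r. x \<ge> 0 \<and> r > 0} \<subseteq> dyadic_intervals \<union> {{0..}}"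
      using diffusion_ball_cases[OF assms] by blast
    show "dyadic_intervals \<union> {{0..}} \<subseteq> {diffusion_ball s t x r | x r. x \<ge> 0 \<and> r > 0}"
      using dyadic_interval_is_ball[OF assms] halfline_is_ball[OF assms]
      unfolding dyadic_intervals_def by blast
  qed
qed

end
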